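(* Let $f=(f_1,f_2)$ be a Keller map with a component $V$ of its finiteness variety, and let $x_1=u^m$, $x_2=\sum_{i=0}^{N-1}h_iu^{m-i}+\gamma u^{m-N}$ be the associated $u$-$\gamma$ representation (see context). Write $f(\hat C(\gamma,u))=(a(\gamma,u),b(\gamma,u))$, $\chi_1=\frac{\partial a}{\partial\gamma}$ and $\psi_1=\frac{\partial b}{\partial \gamma}$. Then the Jacobian matrix of $f$ at the point $\hat C(\gamma,u)$ is $$J(f) = \begin{bmatrix} \dfrac{u^{m-N} + \chi_1r_3}{\psi_1} & \chi_1 u^{N-m} \\ r_3 & \psi_1 u^{N-m} \end{bmatrix},$$ where $$r_3 = \frac{\dfrac{\partial b}{\partial u} - \psi_1 u^{N-m}\left[\sum_{i=0}^{N-1}(m-i)h_iu^{m-i-1}+(m-N)\gamma u^{m-N-1}\right]}{m u^{m-1}} .$$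
   Context: Work over $\mathbf{C}$. $f=(f_1,f_2):X_0=\mathbf{A}^2\to Y_0=\mathbf{A}^2$ is a Keller map (polynomial, Jacobian determinant identically $1$). $V_f\subset Y_0$ is the set of points over which $f$ is not proper, and $V$ is an irreducible (codimension one) component. $X=\mathbf{P}^2\supset X_0$. $\hat X\to X$ is a composition of point blowups over the line at infinity, and $\Gamma\subset \hat X$ is an irreducible curve over infinity such that $f$ extends to a rational map on $\hat X$ that is defined almost everywhere on $\Gamma$ and maps $\Gamma$ densely onto $V$. Coordinates are chosen so that $\Gamma$ maps to a point $[1:\alpha:0]$ of the line at infinity. The $u$-$\gamma$ representation: $m\ge1$ is the order of vanishing of $1/x_1$ along $\Gamma$. Choose locally near a generic point of $\Gamma$ a function $s$ with $s^m=1/x_1$, and expand $x_2/x_1=\sum_{i\ge0}\beta_i s^i$ with $\beta_i$ local functions on $\Gamma$. $N$ is the first index with $\beta_N$ nonconstant, $h_i=\beta_i\in\mathbf{C}$ for $i<N$, $\gamma$ is the parameter given by $\beta_N$, and $u=s^{-1}$. Truncating after index $N$ gives $$\hat C(\gamma,u)=\Big(u^m,\ \textstyle\sum_{i=0}^{N-1}h_iu^{m-i}+\gamma u^{m-N}\Big),$$ and $f(\hat C(\gamma,u))=(a(\gamma,u),b(\gamma,u))$ with $a=\sum_{i\ge0}a_i(\gamma)u^{-i}$ and $b=\sum_{i\ge0}b_i(\gamma)u^{-i}$ polynomials in $\gamma$ and $u^{-1}$; $\gamma\mapsto(a_0(\gamma),b_0(\gamma))$ parametrizes $V$. The identity in the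 claim is an identity of rational functions in $u,\gamma$ ($\psi_1$ is not identically zero). *)

theory Defs
  imports "HOL-Analysis.Analysis"
begin

text \<open>The affine plane over the complex numbers is \<^typ>\<open>complex^2\<close>. A polynomial in two variables is a
  \<^typ>\<open>complex poly poly\<close>: the outer variable stands for the second coordinate, and the
  coefficients are polynomials in the first coordinate.\<close>

definition poly2 :: "complex poly poly \<Rightarrow> complex^2 \<Rightarrow> complex" where
  "poly2 P x = poly (poly P [:x$2:]) (x$1)"

definition polynomial_map :: "(complex^2 \<Rightarrow> complex^2) \<Rightarrow> bool" where
  "polynomial_map f \<longleftrightarrow> (\<exists>P Q. \<forall>x. f x = vector [poly2 P x, poly2 Q x])"

text \<open>\<^term>\<open>jacobian\<close> is built from the real Frechet derivative. For a polynomial map that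
  derivative is complex linear, so the entries, its values on the vectors \<^term>\<open>axis j 1\<close>,
  are the complex partial derivatives.\<close>

definition keller_map :: "(complex^2 \<Rightarrow> complex^2) \<Rightarrow> bool" where
  "keller_map f \<longleftrightarrow> polynomial_map f \<and> (\<forall>x. det (jacobian f (at x)) = 1)"

definition algebraic_set :: "(complex^2) set \<Rightarrow> bool" where
  "algebraic_set S \<longleftrightarrow> (\<exists>F. S = {x. \<forall>P\<in>F. poly2 P x = 0})"

definition zariski_closure :: "(complex^2) set \<Rightarrow> (complex^2) set" where
  "zariski_closure S = \<Inter> {Z. algebraic_set Z \<and> S \<subseteq> Z}"

definition irreducible_algebraic_set :: "(complex^2) set \<Rightarrow> bool" where
  "irreducible_algebraic_set S \<longleftrightarrow> algebraic_set S \<and> S \<noteq> {} \<and>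
     (\<forall>A B. algebraic_set A \<and> algebraic_set B \<and> S \<subseteq> A \<union> B \<longrightarrow> S \<subseteq> A \<or> S \<subseteq> B)"

definition nonproperness_set :: "(complex^2 \<Rightarrow> complex^2) \<Rightarrow> (complex^2) set" where
  "nonproperness_set f =
     {y. \<not> (\<exists>U. open U \<and> y \<in> U \<and> proper_map (top_of_set (f -` U)) (top_of_set U) f)}"

text \<open>The last clause says that the component has codimension one.\<close>

definition nonproperness_component :: "(complex^2 \<Rightarrow> complex^2) \<Rightarrow> (complex^2) set \<Rightarrow> bool" where
  "nonproperness_component f V \<longleftrightarrow>
     irreducible_algebraic_set V \<and> V \<subseteq> nonproperness_set f \<and>
     (\<forall>W. irreducible_algebraic_set W \<and> V \<subseteq> W \<and> W \<subseteq> nonproperness_set f \<longrightarrow> W = V) \<and>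
     (\<exists>P. P \<noteq> 0 \<and> V = {x. poly2 P x = 0})"

text \<open>The part of the projective plane around the points \<open>[1 : \<alpha> : 0]\<close> at infinity has affine
  coordinates \<open>(w, t) = (1/x\<^sub>1, x\<^sub>2/x\<^sub>1)\<close>, in which the line at infinity is \<open>w = 0\<close>.
  The next function goes from these coordinates (with \<open>w \<noteq> 0\<close>) to \<open>(x\<^sub>1, x\<^sub>2)\<close>.\<close>

definition affine_point :: "complex^2 \<Rightarrow> complex^2" where
  "affine_point y = vector [1 / y$1, y$2 / y$1]"

text \<open>The two standard affine charts of the blowup of an affine plane at the point \<open>c\<close>. The
  exceptional curve is \<open>x$1 = 0\<close> in the first chart (where it misses only one point of the
  curve) and \<open>x$2 = 0\<close> in the second.\<close>

definition blowup_chart1 :: "complex^2 \<Rightarrow> complex^2 \<Rightarrow> complex^2" where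
  "blowup_chart1 c x = vector [c$1 + x$1, c$2 + x$1 * x$2]"

definition blowup_chart2 :: "complex^2 \<Rightarrow> complex^2 \<Rightarrow> complex^2" where
  "blowup_chart2 c x = vector [c$1 + x$1 * x$2, c$2 + x$2]"

text \<open>Affine charts of the surfaces obtained by successively blowing up points over infinity. A
  chart is recorded as the polynomial map to the \<open>(w, t)\<close>-plane given by the blowing down.\<close>

inductive infinity_chart :: "(complex^2 \<Rightarrow> complex^2) \<Rightarrow> bool" where
  base: "infinity_chart (\<lambda>x. x)"
| chart1: "infinity_chart \<phi> \<Longrightarrow> \<phi> c $ 1 = 0 \<Longrightarrow> infinity_chart (\<phi> \<circ> blowup_chart1 c)"
| chart2: "infinity_chart \<phi> \<Longrightarrow> \<phi> c $ 1 = 0 \<Longrightarrow> infinity_chart (\<phi> \<circ> blowup_chart2 c)"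

text \<open>An irreducible curve \<open>\<Gamma>\<close> that is contracted to a point \<open>[1 : \<alpha> : 0]\<close> is the exceptional curve
  of one of the blowups. It is represented by a chart \<open>\<phi>\<close> of that blowup in which \<open>\<Gamma>\<close> is
  \<open>x$1 = 0\<close>, so that \<open>x$2\<close> is a coordinate on \<open>\<Gamma>\<close>. Blowups at other points do not change the
  surface near a generic point of \<open>\<Gamma>\<close>.\<close>

definition exceptional_chart :: "(complex^2 \<Rightarrow> complex^2) \<Rightarrow> bool" where
  "exceptional_chart \<phi> \<longleftrightarrow>
     (\<exists>\<psi> c. infinity_chart \<psi> \<and> \<psi> c $ 1 = 0 \<and> \<phi> = \<psi> \<circ> blowup_chart1 c)"

text \<open>In the chart \<open>\<phi>\<close>, \<open>f\<close> is the rational map \<open>(A/D, B/D)\<close>, which is defined almost everywhere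
  on \<open>\<Gamma>\<close> because \<open>D\<close> does not vanish identically there.\<close>

definition maps_densely_onto ::
  "(complex^2 \<Rightarrow> complex^2) \<Rightarrow> (complex^2 \<Rightarrow> complex^2) \<Rightarrow> (complex^2) set \<Rightarrow> bool" where
  "maps_densely_onto f \<phi> V \<longleftrightarrow>
     (\<exists>A B D.
        (\<exists>x. x$1 = 0 \<and> poly2 D x \<noteq> 0) \<and>
        (\<forall>x. \<phi> x $ 1 \<noteq> 0 \<and> poly2 D x \<noteq> 0 \<longrightarrow>
           f (affine_point (\<phi> x)) = vector [poly2 A x / poly2 D x, poly2 B x / poly2 D x]) \<and>
        zariski_closure
          ((\<lambda>x. vector [poly2 A x / poly2 D x, poly2 B x / poly2 D x]) `
             {x. x$1 = 0 \<and> poly2 D x \<noteq> 0}) = V)"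

definition complex_differentiable_on :: "(complex^2 \<Rightarrow> complex) \<Rightarrow> (complex^2) set \<Rightarrow> bool" where
  "complex_differentiable_on s U \<longleftrightarrow>
     (\<forall>x\<in>U. \<exists>a b. (s has_derivative (\<lambda>v. a * v$1 + b * v$2)) (at x))"

text \<open>The data \<open>m\<close>, \<open>N\<close>, \<open>h\<close> of the expansion along \<open>\<Gamma>\<close>. On \<open>\<Gamma>\<close> the function \<open>1/x\<^sub>1\<close> vanishes to
  order exactly \<open>m\<close>. The open set \<open>U\<close> is a neighbourhood of a generic point \<open>(0, q)\<close> of \<open>\<Gamma>\<close>, and
  local functions on \<open>\<Gamma>\<close> are holomorphic functions of the coordinate \<open>x$2\<close>.\<close>

definition u_gamma_representation ::
  "(complex^2 \<Rightarrow> complex^2) \<Rightarrow> nat \<Rightarrow> nat \<Rightarrow> (nat \<Rightarrow> complex) \<Rightarrow> bool" where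
  "u_gamma_representation \<phi> m N h \<longleftrightarrow> m \<ge> 1 \<and>
     (\<exists>R q r s \<beta>. let U = {x. norm (x$1) < r \<and> x$2 \<in> ball q r} in
        (\<forall>x. \<phi> x $ 1 = (x$1)^m * poly2 R x) \<and>
        r > 0 \<and> (\<forall>x\<in>U. poly2 R x \<noteq> 0) \<and>
        complex_differentiable_on s U \<and>
        (\<forall>x\<in>U. s x ^ m = \<phi> x $ 1) \<and>
        (\<forall>i. \<beta> i holomorphic_on ball q r) \<and>
        (\<forall>x\<in>U. (\<lambda>i. \<beta> i (x$2) * s x ^ i) sums (\<phi> x $ 2)) \<and>
        (\<forall>i<N. \<forall>z\<in>ball q r. \<beta> i z = h i) \<and>
        \<not> \<beta> N constant_on ball q r)"

definition C_hat :: "nat \<Rightarrow> nat \<Rightarrow> (nat \<Rightarrow> complex) \<Rightarrow> complex \<Rightarrow> complex \<Rightarrow> complex^2" where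
  "C_hat m N h \<gamma> u =
     vector [u ^ m, (\<Sum>i<N. h i * u powi (int m - int i)) + \<gamma> * u powi (int m - int N)]"

end

theory Submission
  imports Defs "HOL-Computational_Algebra.Fundamental_Theorem_Algebra"
begin

text \<open>The formula is the chain rule for \<open>f \<circ> C_hat\<close>, solved for the entries of \<open>jacobian f\<close>; the
  remaining entry comes from the determinant being 1. If \<open>\<psi>1\<close> vanished identically, then so would
  \<open>\<partial>f\<^sub>2/\<partial>x\<^sub>2\<close>, because the points \<open>C_hat m N h \<gamma> u\<close> with \<open>u \<noteq> 0\<close> fill the set
  \<open>x\<^sub>1 \<noteq> 0\<close>. The Keller condition would then make \<open>f\<close> a triangular automorphism
  \<open>(x\<^sub>1, x\<^sub>2) \<mapsto> (g(x\<^sub>1) - x\<^sub>2/c, c x\<^sub>1 + d)\<close>, which is proper everywhere and leaves no room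
  for \<open>V\<close>.\<close>

section \<open>Polynomials on the plane and their partial derivatives\<close>

lemma poly2_pCons: "poly2 (pCons p P) x = poly p (x$1) + x$2 * poly2 P x"
  by (simp add: poly2_def)

lemma vector_2_eq_iff: "x = y \<longleftrightarrow> x$1 = y$1 \<and> x$2 = y$2" for x y :: "'a^2"
  by (simp add: vec_eq_iff forall_2)

lemma has_derivative_vector_2:
  fixes p q :: "'a::real_normed_vector \<Rightarrow> complex"
  assumes "(p has_derivative p') F" "(q has_derivative q') F"
  shows "((\<lambda>x. vector [p x, q x] :: complex^2) has_derivative (\<lambda>v. vector [p' v, q' v])) F"
proof -
  have lin: "bounded_linear (axis k :: complex \<Rightarrow> complex^2)" for k
    by (intro linear_conv_bounded_linear[THEN iffD1] linearI) (auto simp: axis_def vec_eq_iff)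
  \<comment> \<open>The two coordinate embeddings are bounded linear over the reals, so a pair is
    differentiated componentwise.\<close>
  have eq: "(vector [z, w] :: complex^2) = axis 1 z + axis 2 w" for z w :: complex
    by (simp add: vector_2_eq_iff axis_def)
  show ?thesis
    unfolding eq
    by (intro has_derivative_add bounded_linear.has_derivative[OF lin] assms)
qed

lemma continuous_on_vector_2:
  fixes p q :: "'a::topological_space \<Rightarrow> complex"
  assumes "continuous_on S p" "continuous_on S q"
  shows "continuous_on S (\<lambda>x. vector [p x, q x] :: complex^2)"
proof -
  have eq: "(vector [z, w] :: complex^2) = (\<chi> i. if i = 1 then z else w)" for z w :: complex
    by (simp add: vector_2_eq_iff)
  show ?thesis
    unfolding eq
  proof (intro continuous_on_vec_lambda)
    fix i :: 2
    show "continuous_on S (\<lambda>x. if i = 1 then p x else q x)"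
      using assms by (cases "i = 1") auto
  qed
qed

text \<open>The partial derivatives are kept as polynomials, so that identities found on a dense set
  can be extended to the whole plane. The derivative is the real Frechet one, as in
  \<open>jacobian\<close>, with a complex linear value.\<close>

definition has_partials ::
  "complex poly poly \<Rightarrow> complex poly poly \<Rightarrow> complex poly poly \<Rightarrow> bool" where
  "has_partials P P1 P2 \<longleftrightarrow>
     (\<forall>x. (poly2 P has_derivative (\<lambda>v. poly2 P1 x * v$1 + poly2 P2 x * v$2)) (at x))"

lemma has_partials_exist: "\<exists>P1 P2. has_partials P P1 P2"
proof (induction P)
  case 0
  have "has_partials 0 0 0"
    by (simp add: has_partials_def poly2_def[abs_def])
  then show ?case by blast
next
  case (pCons p P)
  then obtain P1 P2 where P:
    "(poly2 P has_derivative (\<lambda>v. poly2 P1 x * v$1 + poly2 P2 x * v$2)) (at x)" for x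
    unfolding has_partials_def by blast
  have nth: "((\<lambda>x. x$i) has_derivative (\<lambda>v. v$i)) F" for i :: 2 and F :: "(complex^2) filter"
    by (rule bounded_linear_imp_has_derivative) (rule bounded_linear_vec_nth)
  have p: "((\<lambda>x. poly p (x$1)) has_derivative (\<lambda>v. poly (pderiv p) (x$1) * v$1)) (at x)"
    for x :: "complex^2"
    using has_derivative_compose[OF nth[of 1 "at x"]
        poly_DERIV[of p "x$1", THEN has_field_derivative_imp_has_derivative]] by simp
  \<comment> \<open>Horner's form \<open>p(x1) + x2 * P(x)\<close> and the product rule give both
    partials; \<open>pCons 0 P2\<close> is \<open>P2\<close> multiplied by the second
    variable.\<close>
  have "has_partials (pCons p P) (pCons (pderiv p) P1) (P + pCons 0 P2)"
    unfolding has_partials_def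
  proof
    fix x :: "complex^2"
    have add: "poly2 (P + pCons 0 P2) x = poly2 P x + x$2 * poly2 P2 x"
      by (simp add: poly2_def)
    have "((\<lambda>x. poly p (x$1) + x$2 * poly2 P x) has_derivative
        (\<lambda>v. poly (pderiv p) (x$1) * v$1 +
           (x$2 * (poly2 P1 x * v$1 + poly2 P2 x * v$2) + v$2 * poly2 P x))) (at x)"
      by (intro has_derivative_add has_derivative_mult p nth P)
    then show "(poly2 (pCons p P) has_derivative
        (\<lambda>v. poly2 (pCons (pderiv p) P1) x * v$1 + poly2 (P + pCons 0 P2) x * v$2)) (at x)"
      by (simp add: poly2_pCons[abs_def] add algebra_simps)
  qed
  then show ?case by blast
qed

text \<open>Complex linearity of the derivative of \<open>poly2 P\<close> turns the real chain rule
  along a complex curve into a complex derivative.\<close>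

lemma has_partials_chain:
  assumes "has_partials P P1 P2"
    and "(p has_field_derivative p') (at t)" "(q has_field_derivative q') (at t)"
  shows "((\<lambda>t. poly2 P (vector [p t, q t])) has_field_derivative
      poly2 P1 (vector [p t, q t]) * p' + poly2 P2 (vector [p t, q t]) * q') (at t)"
proof -
  have "((\<lambda>t. vector [p t, q t] :: complex^2) has_derivative (\<lambda>v. vector [p' * v, q' * v])) (at t)"
    by (intro has_derivative_vector_2 assms(2,3)[THEN has_field_derivative_imp_has_derivative])
  from has_derivative_compose[OF this, of "poly2 P"] assms(1)
  have "((\<lambda>t. poly2 P (vector [p t, q t])) has_derivative
      (\<lambda>v. poly2 P1 (vector [p t, q t]) * (p' * v) + poly2 P2 (vector [p t, q t]) * (q' * v))) (at t)"
    unfolding has_partials_def by fastforce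
  then show ?thesis
    by (rule has_derivative_imp_has_field_derivative) (simp add: algebra_simps)
qed

lemma jacobian_polynomial_map:
  fixes f :: "complex^2 \<Rightarrow> complex^2"
  assumes "\<And>x. f x = vector [poly2 P x, poly2 Q x]"
    and "has_partials P P1 P2" "has_partials Q Q1 Q2"
  shows "jacobian f (at x) = vector [vector [poly2 P1 x, poly2 P2 x], vector [poly2 Q1 x, poly2 Q2 x]]"
proof -
  have f: "f = (\<lambda>x. vector [poly2 P x, poly2 Q x])"
    using assms(1) by auto
  have "(f has_derivative (\<lambda>v. vector [poly2 P1 x * v$1 + poly2 P2 x * v$2,
      poly2 Q1 x * v$1 + poly2 Q2 x * v$2])) (at x)"
    unfolding f using assms(2,3) by (intro has_derivative_vector_2) (auto simp: has_partials_def)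
  then show ?thesis
    by (simp add: jacobian_def frechet_derivative_at[symmetric] matrix_def vec_eq_iff forall_2 axis_def)
qed

lemma keller_map_polynomials:
  assumes "keller_map f"
  obtains P P1 P2 Q Q1 Q2 where
    "\<And>x. f x = vector [poly2 P x, poly2 Q x]"
    "has_partials P P1 P2" "has_partials Q Q1 Q2"
    "\<And>x. jacobian f (at x) =
       vector [vector [poly2 P1 x, poly2 P2 x], vector [poly2 Q1 x, poly2 Q2 x]]"
    "\<And>x. poly2 P1 x * poly2 Q2 x - poly2 P2 x * poly2 Q1 x = 1"
proof -
  from assms obtain P Q where f: "\<And>x. f x = vector [poly2 P x, poly2 Q x]"
    and det: "\<And>x. det (jacobian f (at x)) = 1"
    unfolding keller_map_def polynomial_map_def by blast
  obtain P1 P2 where P: "has_partials P P1 P2" using has_partials_exist by blast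
  obtain Q1 Q2 where Q: "has_partials Q Q1 Q2" using has_partials_exist by blast
  note J = jacobian_polynomial_map[OF f P Q]
  have "poly2 P1 x * poly2 Q2 x - poly2 P2 x * poly2 Q1 x = 1" for x
    using det[of x] by (simp add: J det_2)
  from that[OF f P Q J this] show thesis .
qed

section \<open>Properness when the second partial of \<open>Q\<close> vanishes\<close>

text \<open>For fixed \<open>x$2\<close> this is a polynomial in one variable with infinitely many
  roots.\<close>

lemma poly2_eq_0_if_eq_0_off_axis:
  assumes "\<And>x. x$1 \<noteq> 0 \<Longrightarrow> poly2 P x = 0"
  shows "poly2 P x = 0"
proof -
  let ?p = "poly P [:x$2:]"
  have "poly ?p z = 0" if "z \<noteq> 0" for z
    using assms[of "vector [z, x$2]"] that by (simp add: poly2_def)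
  then have "- {0} \<subseteq> {z. poly ?p z = 0}" by auto
  moreover have "infinite (- {0 :: complex})"
    by (simp add: finite_compl infinite_UNIV_char_0)
  ultimately have "?p = 0"
    using poly_roots_finite[of ?p] finite_subset by blast
  then show ?thesis by (simp add: poly2_def)
qed

lemma has_field_derivative_const_imp_affine:
  fixes g :: "complex \<Rightarrow> complex"
  assumes "\<And>z. (g has_field_derivative c) (at z)"
  shows "g z = c * z + g 0"
proof -
  have "((\<lambda>z. g z - c * z) has_field_derivative 0) (at z within UNIV)" for z
    by (auto intro!: derivative_eq_intros assms)
  then obtain k where "\<And>z. g z - c * z = k"
    using has_field_derivative_zero_constant[of UNIV "\<lambda>z. g z - c * z"] by auto
  from this[of z] this[of 0] show ?thesis by (simp add: algebra_simps)
qed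

text \<open>Homeomorphisms are proper, so \<open>UNIV\<close> serves as the neighbourhood of every
  point.\<close>

lemma nonproperness_set_eq_empty_if_homeomorphic_map:
  assumes "homeomorphic_map euclidean euclidean f"
  shows "nonproperness_set f = {}"
  using homeomorphic_imp_proper_map[OF assms] unfolding nonproperness_set_def
  by (auto intro!: exI[of _ UNIV])

text \<open>The Keller condition reduces to \<open>P2 * Q1 = -1\<close>. As \<open>Q\<close> depends
  on the first coordinate only, \<open>Q1\<close> is the derivative of a one-variable polynomial and
  has no zeros, hence is a constant \<open>c\<close>. Then \<open>P2\<close> is constant too, and
  integrating gives an explicitly invertible map.\<close>

lemma nonproperness_set_eq_empty_if_partial_eq_0:
  assumes f: "\<And>x. f x = vector [poly2 P x, poly2 Q x]"
    and P: "has_partials P P1 P2" and Q: "has_partials Q Q1 Q2"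
    and det: "\<And>x. poly2 P1 x * poly2 Q2 x - poly2 P2 x * poly2 Q1 x = 1"
    and Q2: "\<And>x. poly2 Q2 x = 0"
  shows "nonproperness_set f = {}"
proof -
  have det': "poly2 P2 x * poly2 Q1 x = - 1" for x
    using det[of x] by (simp add: Q2) (metis minus_minus)
  \<comment> \<open>These are the restrictions to the axis \<open>x$2 = 0\<close>: the argument
    \<open>0\<close> is the zero polynomial, substituted for the outer variable.\<close>
  define q where "q = poly Q 0"
  define g where "g = poly (poly P 0)"
  have Qq: "poly2 Q (vector [z, t]) = poly q z" for z t
  proof -
    have "((\<lambda>t. poly2 Q (vector [z, t])) has_field_derivative 0) (at t)" for t
      using has_partials_chain[OF Q DERIV_const[of z] DERIV_ident, of t] by (simp add: Q2)
    from has_field_derivative_const_imp_affine[OF this] show ?thesis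
      by (simp add: poly2_def q_def)
  qed
  have Q1q: "poly2 Q1 (vector [z, t]) = poly (pderiv q) z" for z t
    using has_partials_chain[OF Q DERIV_ident DERIV_const[of t], of z]
    by (intro DERIV_unique[OF _ poly_DERIV]) (simp add: Qq)
  have "poly (pderiv q) z \<noteq> 0" for z
    using det'[of "vector [z, 0]"] by (auto simp: Q1q)
  \<comment> \<open>Over the complex numbers a polynomial without zeros is constant.\<close>
  then have "constant (poly (pderiv q))"
    using fundamental_theorem_of_algebra by blast
  then obtain c where c: "\<And>z. poly (pderiv q) z = c"
    unfolding constant_def by metis
  with \<open>\<And>z. poly (pderiv q) z \<noteq> 0\<close> have "c \<noteq> 0" by metis
  define d where "d = poly q 0"
  have qc: "poly q z = c * z + d" for z
    unfolding d_def by (rule has_field_derivative_const_imp_affine) (metis c poly_DERIV)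
  have P2: "poly2 P2 (vector [z, t]) = - 1 / c" for z t
    using det'[of "vector [z, t]"] \<open>c \<noteq> 0\<close> by (simp add: Q1q c field_simps)
  have Pg: "poly2 P (vector [z, t]) = g z - t / c" for z t
  proof -
    have "((\<lambda>t. poly2 P (vector [z, t])) has_field_derivative - 1 / c) (at t)" for t
      using has_partials_chain[OF P DERIV_const[of z] DERIV_ident, of t] by (simp add: P2)
    from has_field_derivative_const_imp_affine[OF this, of t] show ?thesis
      by (simp add: poly2_def g_def)
  qed
  have eta: "vector [x$1, x$2] = x" for x :: "complex^2"
    by (simp add: vector_2_eq_iff)
  have fx: "f x = vector [g (x$1) - x$2 / c, c * x$1 + d]" for x
    using f[of x] Pg[of "x$1" "x$2"] Qq[of "x$1" "x$2"] by (simp add: eta qc)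
  \<comment> \<open>The second component of \<open>f\<close> determines \<open>x$1\<close>; the
    first is then solved for \<open>x$2\<close>.\<close>
  let ?inv = "\<lambda>y :: complex^2. vector [(y$2 - d) / c, c * (g ((y$2 - d) / c) - y$1)] :: complex^2"
  have "homeomorphic_maps euclidean euclidean f ?inv"
    unfolding homeomorphic_maps_def
  proof (intro conjI ballI)
    show "continuous_map euclidean euclidean f"
      unfolding fx[abs_def] g_def continuous_map_iff_continuous2
      using \<open>c \<noteq> 0\<close> by (intro continuous_on_vector_2 continuous_intros) auto
    show "continuous_map euclidean euclidean ?inv"
      unfolding g_def continuous_map_iff_continuous2
      using \<open>c \<noteq> 0\<close> by (intro continuous_on_vector_2 continuous_intros) auto
  qed (use \<open>c \<noteq> 0\<close> in \<open>simp_all add: fx vector_2_eq_iff\<close>)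
  then show ?thesis
    using nonproperness_set_eq_empty_if_homeomorphic_map homeomorphic_map_maps by blast
qed

section \<open>The parametrization \<open>C_hat\<close> and its derivatives\<close>

text \<open>Take an \<open>m\<close>-th root \<open>u\<close> of \<open>x$1\<close>; the second
  coordinate is then affine in \<gamma> with nonzero slope, so it can be solved for
  \<gamma>.\<close>

lemma C_hat_surj_off_axis:
  assumes "m \<ge> 1" "x$1 \<noteq> 0"
  obtains \<gamma> u where "u \<noteq> 0" "C_hat m N h \<gamma> u = x"
proof -
  obtain u where "u \<noteq> 0" and u: "u ^ m = x$1"
    using assms exists_complex_root_nonzero[of "x$1" m] by (metis not_one_le_zero)
  define \<gamma> where "\<gamma> = (x$2 - (\<Sum>i<N. h i * u powi (int m - int i))) / u powi (int m - int N)"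
  have "C_hat m N h \<gamma> u = x"
    using \<open>u \<noteq> 0\<close> by (simp add: C_hat_def vector_2_eq_iff u \<gamma>_def)
  with \<open>u \<noteq> 0\<close> show thesis by (rule that)
qed

text \<open>The first coordinate of \<open>C_hat\<close> does not involve \<gamma>, so only the
  second partial contributes.\<close>

lemma has_partials_C_hat_gamma:
  assumes "has_partials P P1 P2"
  shows "((\<lambda>\<gamma>. poly2 P (C_hat m N h \<gamma> u)) has_field_derivative
      poly2 P2 (C_hat m N h \<gamma> u) * u powi (int m - int N)) (at \<gamma>)"
  unfolding C_hat_def
  by (rule DERIV_cong, rule has_partials_chain[OF assms])
     (auto intro!: derivative_eq_intros)

text \<open>The condition \<open>u \<noteq> 0\<close> is there because the exponents
  \<open>m - i\<close> and \<open>m - N\<close> may be negative.\<close>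

lemma has_partials_C_hat_u:
  assumes "has_partials P P1 P2" "u \<noteq> 0"
  shows "((\<lambda>u. poly2 P (C_hat m N h \<gamma> u)) has_field_derivative
      poly2 P1 (C_hat m N h \<gamma> u) * (of_nat m * u ^ (m - 1)) +
      poly2 P2 (C_hat m N h \<gamma> u) *
        ((\<Sum>i<N. of_int (int m - int i) * h i * u powi (int m - int i - 1))
          + of_int (int m - int N) * \<gamma> * u powi (int m - int N - 1))) (at u)"
proof -
  have pw: "((\<lambda>u. u powi k) has_field_derivative of_int k * u powi (k - 1)) (at u)" for k
    using DERIV_power_int[OF DERIV_ident, of k u] assms(2) by simp
  have "((\<lambda>u. u ^ m) has_field_derivative of_nat m * u ^ (m - 1)) (at u)"
    by (auto intro!: derivative_eq_intros)
  moreover have "((\<lambda>u. (\<Sum>i<N. h i * u powi (int m - int i)) + \<gamma> * u powi (int m - int N))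
      has_field_derivative (\<Sum>i<N. of_int (int m - int i) * h i * u powi (int m - int i - 1))
          + of_int (int m - int N) * \<gamma> * u powi (int m - int N - 1)) (at u)"
  proof -
    have "((\<lambda>u. c * u powi k) has_field_derivative of_int k * c * u powi (k - 1)) (at u)" for c k
      using DERIV_cmult[OF pw[of k], of c] by (simp add: mult_ac)
    then show ?thesis
      by (intro DERIV_add DERIV_sum)
  qed
  ultimately show ?thesis
    unfolding C_hat_def by (rule has_partials_chain[OF assms(1)])
qed

theorem theorem10:
  fixes f :: "complex^2 \<Rightarrow> complex^2"
    and V :: "(complex^2) set"
    and \<phi> :: "complex^2 \<Rightarrow> complex^2"
    and m N :: nat
    and h :: "nat \<Rightarrow> complex"
    and a b \<chi>1 \<psi>1 r3 :: "complex \<Rightarrow> complex \<Rightarrow> complex"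
  assumes "keller_map f"
    and "nonproperness_component f V"
    and "exceptional_chart \<phi>"
    and "maps_densely_onto f \<phi> V"
    and "u_gamma_representation \<phi> m N h"
    and "\<And>\<gamma> u. a \<gamma> u = f (C_hat m N h \<gamma> u) $ 1"
    and "\<And>\<gamma> u. b \<gamma> u = f (C_hat m N h \<gamma> u) $ 2"
    and "\<And>\<gamma> u. \<chi>1 \<gamma> u = deriv (\<lambda>g. a g u) \<gamma>"
    and "\<And>\<gamma> u. \<psi>1 \<gamma> u = deriv (\<lambda>g. b g u) \<gamma>"
    and "\<And>\<gamma> u. r3 \<gamma> u =
           (deriv (\<lambda>v. b \<gamma> v) u
             - \<psi>1 \<gamma> u * u powi (int N - int m) *
               ((\<Sum>i<N. of_int (int m - int i) * h i * u powi (int m - int i - 1))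
                 + of_int (int m - int N) * \<gamma> * u powi (int m - int N - 1)))
           / (of_nat m * u ^ (m - 1))"
  shows "(\<exists>\<gamma> u. u \<noteq> 0 \<and> \<psi>1 \<gamma> u \<noteq> 0) \<and>
         (\<forall>\<gamma> u. u \<noteq> 0 \<and> \<psi>1 \<gamma> u \<noteq> 0 \<longrightarrow>
            jacobian f (at (C_hat m N h \<gamma> u)) =
              vector [vector [(u powi (int m - int N) + \<chi>1 \<gamma> u * r3 \<gamma> u) / \<psi>1 \<gamma> u,
                              \<chi>1 \<gamma> u * u powi (int N - int m)],
                      vector [r3 \<gamma> u, \<psi>1 \<gamma> u * u powi (int N - int m)]])"
proof -
  obtain P P1 P2 Q Q1 Q2 where
    f: "\<And>x. f x = vector [poly2 P x, poly2 Q x]"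
    and P: "has_partials P P1 P2" and Q: "has_partials Q Q1 Q2"
    and J: "\<And>x. jacobian f (at x) =
       vector [vector [poly2 P1 x, poly2 P2 x], vector [poly2 Q1 x, poly2 Q2 x]]"
    and det: "\<And>x. poly2 P1 x * poly2 Q2 x - poly2 P2 x * poly2 Q1 x = 1"
    by (rule keller_map_polynomials[OF assms(1)], rule that)
  have m: "m \<ge> 1"
    using assms(5) by (simp add: u_gamma_representation_def)
  have a: "a \<gamma> u = poly2 P (C_hat m N h \<gamma> u)" and b: "b \<gamma> u = poly2 Q (C_hat m N h \<gamma> u)" for \<gamma> u
    by (simp_all add: assms(6,7) f)
  have \<chi>1: "\<chi>1 \<gamma> u = poly2 P2 (C_hat m N h \<gamma> u) * u powi (int m - int N)" for \<gamma> u
    unfolding assms(8) a by (rule DERIV_imp_deriv[OF has_partials_C_hat_gamma[OF P]])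
  have \<psi>1: "\<psi>1 \<gamma> u = poly2 Q2 (C_hat m N h \<gamma> u) * u powi (int m - int N)" for \<gamma> u
    unfolding assms(9) b by (rule DERIV_imp_deriv[OF has_partials_C_hat_gamma[OF Q]])
  have inv: "u powi (int m - int N) * u powi (int N - int m) = 1" if "u \<noteq> 0" for u :: complex
    using that by (simp flip: power_int_add)
  have r3: "r3 \<gamma> u = poly2 Q1 (C_hat m N h \<gamma> u)" if "u \<noteq> 0" for \<gamma> u
  proof -
    \<comment> \<open>With this, the subtracted term in \<open>r3\<close> is exactly the
      \<open>Q2\<close> part of the derivative of \<open>b\<close> in \<open>u\<close>. What remains
      is \<open>Q1\<close> times \<open>m * u ^ (m - 1)\<close>.\<close>
    have "\<psi>1 \<gamma> u * u powi (int N - int m) = poly2 Q2 (C_hat m N h \<gamma> u)"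
      using inv[OF that] by (simp add: \<psi>1 mult.assoc)
    moreover have "of_nat m * u ^ (m - 1) \<noteq> 0"
      using m that by simp
    ultimately show ?thesis
      unfolding assms(10) b DERIV_imp_deriv[OF has_partials_C_hat_u[OF Q that]]
      by (simp del: of_int_diff)
  qed
  have "\<exists>\<gamma> u. u \<noteq> 0 \<and> \<psi>1 \<gamma> u \<noteq> 0"
  proof (rule ccontr)
    assume *: "\<not> ?thesis"
    have "poly2 Q2 x = 0" if x: "x$1 \<noteq> 0" for x
    proof -
      obtain \<gamma> u where "u \<noteq> 0" "C_hat m N h \<gamma> u = x"
        using C_hat_surj_off_axis[OF m x] .
      moreover from this * have "\<psi>1 \<gamma> u = 0" by blast
      ultimately show ?thesis by (simp add: \<psi>1)
    qed
    \<comment> \<open>\<open>C_hat\<close> with \<open>u \<noteq> 0\<close> only reaches points off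
      the axis \<open>x$1 = 0\<close>; polynomiality of \<open>Q2\<close> covers the axis.\<close>
    then have "poly2 Q2 x = 0" for x
      by (rule poly2_eq_0_if_eq_0_off_axis)
    then have "nonproperness_set f = {}"
      by (rule nonproperness_set_eq_empty_if_partial_eq_0[OF f P Q det])
    \<comment> \<open>An irreducible set is nonempty by definition, yet \<open>V\<close> lies in the
      empty nonproperness set.\<close>
    with assms(2) show False
      by (auto simp: nonproperness_component_def irreducible_algebraic_set_def)
  qed
  moreover have "jacobian f (at (C_hat m N h \<gamma> u)) =
      vector [vector [(u powi (int m - int N) + \<chi>1 \<gamma> u * r3 \<gamma> u) / \<psi>1 \<gamma> u,
                      \<chi>1 \<gamma> u * u powi (int N - int m)],
              vector [r3 \<gamma> u, \<psi>1 \<gamma> u * u powi (int N - int m)]]"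
    if u: "u \<noteq> 0" and nz: "\<psi>1 \<gamma> u \<noteq> 0" for \<gamma> u
  proof -
    let ?c = "C_hat m N h \<gamma> u"
    \<comment> \<open>The Keller identity in the form \<open>1 + P2 * Q1 = P1 * Q2\<close>,
      multiplied by \<open>u powi (m - N)\<close>, recovers the remaining entry \<open>P1\<close>
      after division by \<psi>1.\<close>
    have "u powi (int m - int N) + \<chi>1 \<gamma> u * r3 \<gamma> u
        = (1 + poly2 P2 ?c * poly2 Q1 ?c) * u powi (int m - int N)"
      by (simp add: \<chi>1 r3[OF u] algebra_simps)
    also have "\<dots> = poly2 P1 ?c * \<psi>1 \<gamma> u"
      using det[of ?c] by (simp add: \<psi>1 algebra_simps)
    finally have "(u powi (int m - int N) + \<chi>1 \<gamma> u * r3 \<gamma> u) / \<psi>1 \<gamma> u = poly2 P1 ?c"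
      using nz by simp
    moreover have "\<chi>1 \<gamma> u * u powi (int N - int m) = poly2 P2 ?c"
      "\<psi>1 \<gamma> u * u powi (int N - int m) = poly2 Q2 ?c"
      using inv[OF u] by (simp_all add: \<chi>1 \<psi>1 mult.assoc)
    ultimately show ?thesis
      by (simp add: J r3[OF u])
  qed
  ultimately show ?thesis by blast
qed

end
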